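(* Let $(L,\leq,0,1)$ be a bounded lattice and $e\in L\setminus\{0,1\}$. Let $S_e$ be a $t$-conorm on $[e,1]$ and let $U_S: L\times L\to L$ be defined by $$ U_S(x,y)=\begin{cases} 0, & (x,y)\in [0,e)^2,\\ S_e(x,y), & (x,y)\in [e,1]^2,\\ y, & (x,y)\in [e,1]\times I_e,\\ x, & (x,y)\in I_e\times [e,1],\\ x\wedge y, & \text{otherwise.} \end{cases} $$ Then the following statements are equivalent: (i) $U_S$ is a uninorm on $L$ with the neutral element $e$; (ii) either $I_e=\emptyset$, or for any $y,z\in I_e$ it holds that $y\wedge z\in I_e$ or $y\wedge z=0$; (iii) $I_e\wedge I_e\subset I_e\cup\{0\}$; (iv) $\wedge$ is a $t$-norm on $I_e\cup\{0,1\}$.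
   Context: $(L,\leq,0,1)$ is a lattice with bottom element $0$ and top element $1$; $\wedge,\vee$ are infimum and supremum; $x<y$ means $x\leq y$ and $x\neq y$. For $a\leq b$, $[a,b]=\{x\in L: a\leq x\leq b\}$, and $[a,b)$, $(a,b]$, $(a,b)$ are defined similarly (with strict inequality $<$ at the open end). Elements $x,y$ are incomparable, written $x\| y$, if $x\nleq y$ and $y\nleq x$; $I_e=\{x\in L: x\| e\}$. $I_e\wedge I_e=\{y\wedge z: y,z\in I_e\}$. The symbol $\subset$ allows equality. A uninorm on $L$ is a binary operation $U:L^2\to L$ that is commutative, associative, increasing (i.e. order-preserving) in each variable, and has a neutral element $e\in L$, i.e. $U(e,x)=x$ for all $x\in L$. A $t$-norm (resp. $t$-conorm) is a commutative, associative operation, increasing in each variable, whose neutral element is the top (resp. bottom) element. Thus a $t$-conorm on $[e,1]$ is such an operation $[e,1]^2\to[e,1]$ with neutral element $e$. That $\wedge$ is a $t$-norm on $I_e\cup\{0,1\}$ means that the restriction of $\wedge$ to $(I_e\cup\{0,1\})^2$ takes values in $I_e\cup\{0,1\}$ and is commutative, associative, increasing in each variable (for the induced order) with neutral element $1$. *)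

theory Defs
  imports Main
begin

(* The binary operations below are total functions on the type; only their
   restriction to the carrier A is constrained. *)

definition increasing_on :: "'a::order set \<Rightarrow> ('a \<Rightarrow> 'a \<Rightarrow> 'a) \<Rightarrow> bool" where
  "increasing_on A F \<longleftrightarrow>
     (\<forall>x\<in>A. mono_on A (\<lambda>y. F x y)) \<and> (\<forall>y\<in>A. mono_on A (\<lambda>x. F x y))"

definition increasing_comm_semigroup_on :: "'a::order set \<Rightarrow> ('a \<Rightarrow> 'a \<Rightarrow> 'a) \<Rightarrow> bool" where
  "increasing_comm_semigroup_on A F \<longleftrightarrow>
     (\<forall>x\<in>A. \<forall>y\<in>A. F x y \<in> A) \<and>
     (\<forall>x\<in>A. \<forall>y\<in>A. F x y = F y x) \<and>
     (\<forall>x\<in>A. \<forall>y\<in>A. \<forall>z\<in>A. F (F x y) z = F x (F y z)) \<and>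
     increasing_on A F"

definition neutral_on :: "'a set \<Rightarrow> ('a \<Rightarrow> 'a \<Rightarrow> 'a) \<Rightarrow> 'a \<Rightarrow> bool" where
  "neutral_on A F n \<longleftrightarrow> n \<in> A \<and> (\<forall>x\<in>A. F n x = x)"

definition uninorm :: "('a::bounded_lattice \<Rightarrow> 'a \<Rightarrow> 'a) \<Rightarrow> 'a \<Rightarrow> bool" where
  "uninorm U e \<longleftrightarrow> increasing_comm_semigroup_on UNIV U \<and> neutral_on UNIV U e"

definition t_norm_on :: "'a::order set \<Rightarrow> ('a \<Rightarrow> 'a \<Rightarrow> 'a) \<Rightarrow> bool" where
  "t_norm_on A T \<longleftrightarrow> increasing_comm_semigroup_on A T \<and>
     (\<exists>t\<in>A. (\<forall>x\<in>A. x \<le> t) \<and> neutral_on A T t)"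

definition t_conorm_on :: "'a::order set \<Rightarrow> ('a \<Rightarrow> 'a \<Rightarrow> 'a) \<Rightarrow> bool" where
  "t_conorm_on A S \<longleftrightarrow> increasing_comm_semigroup_on A S \<and>
     (\<exists>b\<in>A. (\<forall>x\<in>A. b \<le> x) \<and> neutral_on A S b)"

definition incomparables :: "'a::order \<Rightarrow> 'a set" where
  "incomparables e = {x. \<not> x \<le> e \<and> \<not> e \<le> x}"

definition U_S :: "'a::bounded_lattice \<Rightarrow> ('a \<Rightarrow> 'a \<Rightarrow> 'a) \<Rightarrow> 'a \<Rightarrow> 'a \<Rightarrow> 'a" where
  "U_S e S x y =
     (if (x, y) \<in> {bot..<e} \<times> {bot..<e} then bot
      else if (x, y) \<in> {e..top} \<times> {e..top} then S x y
      else if (x, y) \<in> {e..top} \<times> incomparables e then y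
      else if (x, y) \<in> incomparables e \<times> {e..top} then x
      else inf x y)"

end

theory Submission
  imports Defs
begin

text \<open>Elements of \<^term>\<open>{e..top}\<close> act under \<^term>\<open>U_S e S\<close> as identities on everything outside
  \<^term>\<open>{e..top}\<close>, and the complement of \<^term>\<open>{e..top}\<close> is closed under \<^term>\<open>U_S e S\<close>; so
  associativity only matters on that complement, where the operation is \<^term>\<open>inf\<close> except that
  it gives \<^term>\<open>bot\<close> when both arguments are below \<^term>\<open>e\<close>. If \<open>y\<close> and \<open>z\<close> are incomparable to \<^term>\<open>e\<close> and \<open>w = inf y z\<close> lies below
  \<^term>\<open>e\<close>, then bracketing the product of \<open>y\<close>, \<open>z\<close>, \<open>w\<close> in the two ways gives \<^term>\<open>bot\<close> and
  \<open>w\<close>, which forces \<open>w = bot\<close>; this is the only obstruction.\<close>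

lemma not_le_cases:
  fixes e :: "'a::order"
  assumes "\<not> e \<le> x"
  obtains "x < e" | "x \<in> incomparables e"
  using assms by (auto simp: incomparables_def less_le)

lemma U_S_below:
  "x < e \<Longrightarrow> y < e \<Longrightarrow> U_S e S x y = bot"
  by (simp add: U_S_def)

lemma U_S_above:
  "e \<le> x \<Longrightarrow> e \<le> y \<Longrightarrow> U_S e S x y = S x y"
  by (auto simp: U_S_def)

text \<open>Two branches of \<open>U_S\<close> agree here: the explicit one for incomparable
  \<open>y\<close>, and the last one for \<open>y < e\<close>, where \<open>y < e \<le> x\<close>
  collapses the infimum to \<open>y\<close>.\<close>

lemma U_S_above_left:
  assumes "e \<le> x" "\<not> e \<le> y"
  shows "U_S e S x y = y"
  using assms by (auto simp: U_S_def incomparables_def intro: inf_absorb2)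

lemma U_S_above_right:
  assumes "\<not> e \<le> x" "e \<le> y"
  shows "U_S e S x y = x"
  using assms by (auto simp: U_S_def incomparables_def intro: inf_absorb1)

lemma U_S_incomparable_left:
  "x \<in> incomparables e \<Longrightarrow> \<not> e \<le> y \<Longrightarrow> U_S e S x y = inf x y"
  by (auto simp: U_S_def incomparables_def)

lemma U_S_incomparable_right:
  "\<not> e \<le> x \<Longrightarrow> y \<in> incomparables e \<Longrightarrow> U_S e S x y = inf x y"
  by (auto simp: U_S_def incomparables_def)

text \<open>Away from \<open>{e..top}\<close> only the branches \<open>bot\<close> and
  \<open>inf x y\<close> remain. This bound gives closure of the complement and the comparisons in
  the monotonicity proof.\<close>

lemma U_S_le_inf:
  assumes "\<not> e \<le> x" "\<not> e \<le> y"
  shows "U_S e S x y \<le> inf x y"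
  using assms by (auto simp: U_S_def)

lemma U_S_not_above:
  "\<not> e \<le> x \<Longrightarrow> \<not> e \<le> y \<Longrightarrow> \<not> e \<le> U_S e S x y"
  using U_S_le_inf[of e x y S] by (meson inf.boundedE order_trans)

text \<open>Serves associativity: once two of three arguments outside \<open>{e..top}\<close> lie
  below \<open>e\<close>, both bracketings become \<open>bot\<close>.\<close>

lemma U_S_less:
  fixes e :: "'a::bounded_lattice"
  assumes "x < e" "\<not> e \<le> y"
  shows "U_S e S x y < e" "U_S e S y x < e"
proof -
  have "\<not> e \<le> x"
    using assms by auto
  then have "U_S e S x y \<le> x" "U_S e S y x \<le> x"
    using assms U_S_le_inf[of e x y S] U_S_le_inf[of e y x S] by auto
  then show "U_S e S x y < e" "U_S e S y x < e"
    using assms by auto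
qed

lemma incomparables_not_ge: "x \<in> incomparables e \<Longrightarrow> \<not> e \<le> x"
  by (simp add: incomparables_def)

text \<open>With at most one argument below \<open>e\<close>, both bracketings equal the infimum of
  all three; with at least two, both are \<open>bot\<close>.\<close>

lemma U_S_assoc_not_above:
  fixes e :: "'a::bounded_lattice"
  assumes "e \<noteq> bot"
    and C: "\<And>y z. y \<in> incomparables e \<Longrightarrow> z \<in> incomparables e \<Longrightarrow>
              inf y z \<in> incomparables e \<or> inf y z = bot"
    and x: "\<not> e \<le> x" and y: "\<not> e \<le> y" and z: "\<not> e \<le> z"
  shows "U_S e S (U_S e S x y) z = U_S e S x (U_S e S y z)"
proof -
  have bot: "bot < e"
    using \<open>e \<noteq> bot\<close> by (simp add: bot.not_eq_extremum)
  have U_bot [simp]: "U_S e S bot v = bot" "U_S e S v bot = bot" if "\<not> e \<le> v" for v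
    using U_S_le_inf[of e bot v S] U_S_le_inf[of e v bot S] bot that
    by (auto simp: bot_unique)
  note U = U_S_incomparable_left U_S_incomparable_right incomparables_not_ge
  have inf_not_ge: "\<not> e \<le> inf u v" if "\<not> e \<le> u \<or> \<not> e \<le> v" for u v
    using that by auto
  show ?thesis
  proof (cases rule: not_le_cases[OF x])
    case xB: 1
    show ?thesis
    proof (cases rule: not_le_cases[OF y])
      case 1
      then show ?thesis
        using xB z by (simp add: U_S_below U_S_less)
    next
      case yI: 2
      show ?thesis
      proof (cases rule: not_le_cases[OF z])
        case 1
        then show ?thesis
          using xB y by (simp add: U_S_below U_S_less)
      next
        case 2
        \<comment> \<open>A nonzero \<open>inf y z\<close> below \<open>e\<close> would make the
          right-hand side \<open>bot\<close> instead of an infimum; \<open>C\<close> excludes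
          this.\<close>
        then show ?thesis
          using yI x y z C[OF yI 2] by (auto simp: U inf_not_ge inf.assoc)
      qed
    qed
  next
    case xI: 2
    show ?thesis
    proof (cases rule: not_le_cases[OF y])
      case yB: 1
      show ?thesis
      proof (cases rule: not_le_cases[OF z])
        case 1
        then show ?thesis
          using yB x by (simp add: U_S_below U_S_less)
      next
        case 2
        then show ?thesis
          using xI x y z by (simp add: U inf_not_ge inf.assoc)
      qed
    next
      case yI: 2
      \<comment> \<open>Since \<open>z\<close> may lie below \<open>e\<close>, \<open>C\<close> is
        needed: \<open>inf x y\<close> is either incomparable to \<open>e\<close> or already
        \<open>bot\<close>.\<close>
      have "U_S e S (inf x y) z = inf (inf x y) z"
        using C[OF xI yI] z by (auto simp: U)
      then show ?thesis
        using xI yI x y z by (simp add: U inf_not_ge inf.assoc)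
    qed
  qed
qed

text \<open>The neutral element in \<open>t_conorm_on\<close> is only given as some least element;
  antisymmetry identifies it with \<open>e\<close>.\<close>

lemma t_conorm_on_neutral:
  assumes "t_conorm_on {e..top} S" "e \<le> (x :: 'a::bounded_lattice)"
  shows "S e x = x"
proof -
  obtain b where "b \<in> {e..top}" "\<forall>x\<in>{e..top}. b \<le> x" "neutral_on {e..top} S b"
    using assms(1) by (auto simp: t_conorm_on_def)
  moreover from this have "b = e"
    by (auto intro: antisym)
  ultimately show ?thesis
    using assms(2) by (simp add: neutral_on_def)
qed

lemma uninorm_U_SI:
  fixes e :: "'a::bounded_lattice"
  assumes "e \<noteq> bot" and S: "t_conorm_on {e..top} S"
    and C: "\<And>y z. y \<in> incomparables e \<Longrightarrow> z \<in> incomparables e \<Longrightarrow>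
              inf y z \<in> incomparables e \<or> inf y z = bot"
  shows "uninorm (U_S e S) e"
proof -
  let ?U = "U_S e S"
  have semigroup: "increasing_comm_semigroup_on {e..top} S"
    using S by (simp add: t_conorm_on_def)
  have S_closed: "e \<le> S x y" if "e \<le> x" "e \<le> y" for x y
    using semigroup that by (simp add: increasing_comm_semigroup_on_def)
  have S_comm: "S x y = S y x" if "e \<le> x" "e \<le> y" for x y
    using semigroup that unfolding increasing_comm_semigroup_on_def
    by (meson atLeastAtMost_iff top_greatest)
  have S_assoc: "S (S x y) z = S x (S y z)" if "e \<le> x" "e \<le> y" "e \<le> z" for x y z
    using semigroup that unfolding increasing_comm_semigroup_on_def
    by (meson atLeastAtMost_iff top_greatest)
  have S_mono: "S x y \<le> S x' y" if "e \<le> x" "x \<le> x'" "e \<le> y" for x x' y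
    using semigroup that order_trans[OF that(1,2)]
    unfolding increasing_comm_semigroup_on_def increasing_on_def mono_on_def
    by (meson atLeastAtMost_iff top_greatest)
  have S_ge: "x \<le> S x y" if "e \<le> x" "e \<le> y" for x y
    using S_mono[OF order_refl that(2,1)] t_conorm_on_neutral[OF S that(1)] S_comm[OF that]
    by simp

  have comm: "?U x y = ?U y x" for x y
    using S_comm by (auto simp: U_S_def incomparables_def inf.commute)

  have mono: "?U x y \<le> ?U x' y" if "x \<le> x'" for x x' y
  proof (cases "e \<le> y")
    case True
    then show ?thesis
    proof (cases "e \<le> x")
      case True
      then have "e \<le> x'"
        using that by (rule order_trans)
      then show ?thesis
        using True that \<open>e \<le> y\<close> by (simp add: U_S_above S_mono)
    next
      \<comment> \<open>If \<open>x'\<close> has entered \<open>{e..top}\<close>, the chain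
        \<open>x \<le> x' \<le> S x' y\<close> compares the two values.\<close>
      case x: False
      then show ?thesis
        using that \<open>e \<le> y\<close> order_trans[OF that S_ge]
        by (cases "e \<le> x'") (simp_all add: U_S_above U_S_above_right)
    qed
  next
    case y: False
    show ?thesis
    proof (cases "e \<le> x'")
      case True
      then show ?thesis
        using y U_S_le_inf[of e x y S] by (cases "e \<le> x") (auto simp: U_S_above_left)
    next
      case x': False
      then have x: "\<not> e \<le> x"
        using that by auto
      show ?thesis
      \<comment> \<open>If both are below \<open>e\<close>, so is \<open>x\<close>, and both values
        are \<open>bot\<close>; otherwise the larger value is a genuine infimum.\<close>
      proof (cases "x' < e \<and> y < e")
        case True
        then show ?thesis
          using that by (simp add: U_S_below le_less_trans)
      next
        case False
        then have "?U x' y = inf x' y"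
          using x' y by (auto simp: U_S_def)
        then show ?thesis
          using U_S_le_inf[OF x y, of S] inf_mono[OF that order_refl[of y]] order_trans by metis
      qed
    qed
  qed

  have mono_right: "?U x y \<le> ?U x y'" if "y \<le> y'" for x y y'
    using mono[OF that] by (simp only: comm[of x])

  have assoc: "?U (?U x y) z = ?U x (?U y z)" for x y z
  proof (cases "\<not> e \<le> x \<and> \<not> e \<le> y \<and> \<not> e \<le> z")
    case True
    then show ?thesis
      using U_S_assoc_not_above[OF \<open>e \<noteq> bot\<close> C] by blast
  next
    case False
    then show ?thesis
      \<comment> \<open>Arguments in \<open>{e..top}\<close> disappear beside one outside it;
        closure of \<open>{e..top}\<close> and of its complement lets this apply to the inner
        products too.\<close>
      by (cases "e \<le> x"; cases "e \<le> y"; cases "e \<le> z")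
        (simp_all add: U_S_above U_S_above_left U_S_above_right U_S_not_above S_closed S_assoc)
  qed

  have "?U e x = x" for x
    using t_conorm_on_neutral[OF S] by (cases "e \<le> x") (simp_all add: U_S_above U_S_above_left)
  then show ?thesis
    unfolding uninorm_def increasing_comm_semigroup_on_def increasing_on_def neutral_on_def
      mono_on_def
    by (intro conjI ballI allI impI UNIV_I comm assoc mono mono_right; simp)
qed

lemma uninorm_U_SD:
  fixes e :: "'a::bounded_lattice"
  assumes U: "uninorm (U_S e S) e"
    and y: "y \<in> incomparables e" and z: "z \<in> incomparables e"
  shows "inf y z \<in> incomparables e \<or> inf y z = bot"
proof (rule disjCI)
  let ?w = "inf y z"
  assume "?w \<noteq> bot"
  show "?w \<in> incomparables e"
  proof (rule ccontr)
    assume "?w \<notin> incomparables e"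
    moreover have w: "\<not> e \<le> ?w"
      using y by (auto simp: incomparables_def)
    ultimately have "?w < e"
      by (blast elim: not_le_cases)
    then have "bot = U_S e S (U_S e S y z) ?w"
      using y z by (simp add: U_S_incomparable_left incomparables_not_ge U_S_below)
    also have "\<dots> = U_S e S y (U_S e S z ?w)"
      using U by (metis UNIV_I uninorm_def increasing_comm_semigroup_on_def)
    \<comment> \<open>Both \<open>y\<close> and \<open>z\<close> are incomparable to
      \<open>e\<close> and lie above \<open>?w\<close>, so each product is an infimum returning
      \<open>?w\<close>.\<close>
    also have "\<dots> = ?w"
      using y z w by (simp add: U_S_incomparable_left inf.absorb2)
    finally show False
      using \<open>?w \<noteq> bot\<close> by simp
  qed
qed

text \<open>Every subset inherits the algebraic and order laws of \<open>inf\<close>, and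
  \<open>top\<close> is neutral, so only closure is at stake.\<close>

lemma t_norm_on_inf_iff:
  fixes A :: "'a::bounded_lattice set"
  assumes "top \<in> A"
  shows "t_norm_on A inf \<longleftrightarrow> (\<forall>x\<in>A. \<forall>y\<in>A. inf x y \<in> A)"
proof
  assume "\<forall>x\<in>A. \<forall>y\<in>A. inf x y \<in> A"
  then have "increasing_comm_semigroup_on A inf"
    unfolding increasing_comm_semigroup_on_def increasing_on_def mono_on_def
    by (simp add: inf.commute inf.assoc inf.left_commute le_infI1 le_infI2)
  then show "t_norm_on A inf"
    using assms by (auto simp: t_norm_on_def neutral_on_def intro: bexI[of _ top])
qed (simp add: t_norm_on_def increasing_comm_semigroup_on_def)

theorem theorem5:
  fixes e :: "'a::bounded_lattice" and S :: "'a \<Rightarrow> 'a \<Rightarrow> 'a"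
  assumes "e \<noteq> bot" and "e \<noteq> top"
    and "t_conorm_on {e..top} S"
  defines "I \<equiv> incomparables e"
  shows
    "(uninorm (U_S e S) e \<longleftrightarrow>
        I = {} \<or> (\<forall>y\<in>I. \<forall>z\<in>I. inf y z \<in> I \<or> inf y z = bot)) \<and>
     (uninorm (U_S e S) e \<longleftrightarrow>
        {inf y z | y z. y \<in> I \<and> z \<in> I} \<subseteq> I \<union> {bot}) \<and>
     (uninorm (U_S e S) e \<longleftrightarrow>
        t_norm_on (I \<union> {bot, top}) inf)"
proof -
  let ?C = "\<forall>y\<in>I. \<forall>z\<in>I. inf y z \<in> I \<or> inf y z = bot"
  have uninorm: "uninorm (U_S e S) e \<longleftrightarrow> ?C"
  proof
    assume "uninorm (U_S e S) e"
    then show ?C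
      unfolding I_def by (intro ballI uninorm_U_SD)
  next
    assume ?C
    then show "uninorm (U_S e S) e"
      using uninorm_U_SI[OF assms(1,3)] unfolding I_def by simp
  qed
  have "I = {} \<or> ?C \<longleftrightarrow> ?C"
    by auto
  moreover have "{inf y z | y z. y \<in> I \<and> z \<in> I} \<subseteq> I \<union> {bot} \<longleftrightarrow> ?C"
    by auto
  moreover have "t_norm_on (I \<union> {bot, top}) inf \<longleftrightarrow> ?C"
  proof -
    \<comment> \<open>\<open>inf y z = top\<close> would force \<open>y = top\<close>, so adjoining
      \<open>top\<close> admits no new values.\<close>
    have "top \<notin> I"
      by (simp add: I_def incomparables_def)
    then have "inf y z \<in> I \<union> {bot, top} \<longleftrightarrow> inf y z \<in> I \<or> inf y z = bot"
      if "y \<in> I" for y z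
      using that by auto
    then have "?C \<longleftrightarrow> (\<forall>y\<in>I. \<forall>z\<in>I. inf y z \<in> I \<union> {bot, top})"
      by (simp only: cong: ball_cong)
    \<comment> \<open>Pairs involving \<open>bot\<close> or \<open>top\<close> are harmless: the
      infimum is \<open>bot\<close> or the other argument.\<close>
    also have "\<dots> \<longleftrightarrow> (\<forall>y\<in>I \<union> {bot, top}. \<forall>z\<in>I \<union> {bot, top}. inf y z \<in> I \<union> {bot, top})"
      by (simp add: ball_Un)
    also have "\<dots> \<longleftrightarrow> t_norm_on (I \<union> {bot, top}) inf"
      by (simp add: t_norm_on_inf_iff)
    finally show ?thesis
      by (rule sym)
  qed
  ultimately show ?thesis
    by (simp only: uninorm simp_thms)
qed

end
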